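(* Let $f(x)$ be a probability expression in the variable $x$ (a formal expression, as defined in the context). Suppose that evaluating $f(\epsilon)$ in infinitesimal arithmetic, i.e. evaluating the expression with $x$ replaced by the symbolic infinitesimal $\epsilon = 1\epsilon^1$, is not undefined, and that the result is $f(\epsilon) = r\epsilon^n$ with $r\in\mathbb{R}$, $n\in\mathbb{Z}$. Then, viewing $f$ as a (partial) function from reals to reals, $$\lim_{x\to 0}\frac{f(x)}{x^n} = r .$$
   Context: **Infinitesimal numbers.** An infinitesimal number is a pair $(r,n)\in\mathbb{R}\times\mathbb{Z}$, written $r\epsilon^n$ (these are formal pairs; e.g. $0\epsilon^1$ and $0\epsilon^2$ are different). A real number $r$ corresponds to $r\epsilon^0$. The symbol $\epsilon$ denotes $1\epsilon^1$. Arithmetic is defined by $$r\epsilon^{n}\pm s\epsilon^{k}=\begin{cases}(r\pm s)\epsilon^{n} & \text{if } n=k\\ r\epsilon^{n} & \text{if } n<k\\ \pm s\epsilon^{k} & \text{if } n>k\end{cases}$$ $$(r\epsilon^{n})\cdot(s\epsilon^{k})=(r\cdot s)\epsilon^{n+k},\qquad (r\epsilon^{n})/(s\epsilon^{k})=\begin{cases}(r/s)\epsilon^{n-k} & \text{if } s\neq 0\\ \text{undefined} & \text{if } s=0.\end{cases}$$ An expression is undefined if evaluating any of its subexpressions is undefined. **Probability of an interval.** An interval is represented by a midpoint-width pair $(s,w)$, with $s\in\mathbb{R}$ and $w$ a real number or an infinitesimal number; for real $w$ it stands for $[s-\frac12 w, s+\frac12 w]$. For a continuous probability distribution $D$ on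 $\mathbb{R}$ with cumulative distribution function $\mathsf{cdf}(D,\cdot)$ and probability density function $\mathsf{pdf}(D,\cdot)$, $$P(D,(s,w))=\begin{cases}\mathsf{cdf}(D,s+\frac12 r)-\mathsf{cdf}(D,s-\frac12 r) & \text{if } w=r\epsilon^0 \text{ is not infinitesimal (i.e. } w \text{ is the real number } r)\\ \mathsf{pdf}(D,s)\cdot r\epsilon^{n} & \text{if } w=r\epsilon^{n} \text{ with } n>0.\end{cases}$$ **Probability expressions.** A probability expression $f(x)$ in the variable $x$ is an expression built using the operations $+,-,\cdot,/$, real constants, and terms $P(D,(s,rx))$, where $r,s\in\mathbb{R}$ are constants and $D$ is a probability distribution on $\mathbb{R}$ with differentiable cumulative distribution function; here $\mathsf{pdf}(D,\cdot)$ is the derivative of $\mathsf{cdf}(D,\cdot)$. Such an expression can be viewed in two ways. (i) As a partial function from reals to reals, with the ordinary operations and the first case of $P$, defined at those $x$ for which no division by zero occurs. (ii) As a partial function on infinitesimal numbers, by interpreting the operations in infinitesimal arithmetic, each constant $c$ as $c\epsilon^0$, and $P(D,(s,w))$ as $\mathsf{cdf}(D,s+\frac12 r)-\mathsf{cdf}(D,s-\frac12 r)$ when $w=r\epsilon^0$ and as $\mathsf{pdf}(D,s)\cdot r\epsilon^{n}$ when $w=r\epsilon^{n}$ with $n>0$. In particular, at $x=\epsilon$ the term $P(D,(s,rx))$ evaluates to $\mathsf{pdf}(D,s)\cdot r\epsilon^1$. The value $f(\epsilon)$ may depend on the expression, not only on the real function it defines. The limit $x\to0$ is taken over nonzero real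 $x$; the conclusion includes that $f$ is defined for all sufficiently small nonzero real $x$. *)

theory Defs
  imports "HOL-Probability.Probability"
begin

text \<open>\<open>Infinitesimal r n\<close> is the formal pair written $r\epsilon^n$; the coefficient may be zero, so
  \<open>Infinitesimal 0 1\<close> and \<open>Infinitesimal 0 2\<close> are different.\<close>

datatype infinitesimal = Infinitesimal real int

definition const_inf :: "real \<Rightarrow> infinitesimal" where
  "const_inf c = Infinitesimal c 0"

definition eps :: infinitesimal where
  "eps = Infinitesimal 1 1"

instantiation infinitesimal :: "{plus, minus, times}"
begin

fun plus_infinitesimal :: "infinitesimal \<Rightarrow> infinitesimal \<Rightarrow> infinitesimal" where
  "Infinitesimal r n + Infinitesimal s k =
     (if n = k then Infinitesimal (r + s) n
      else if n < k then Infinitesimal r n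
      else Infinitesimal s k)"

fun minus_infinitesimal :: "infinitesimal \<Rightarrow> infinitesimal \<Rightarrow> infinitesimal" where
  "Infinitesimal r n - Infinitesimal s k =
     (if n = k then Infinitesimal (r - s) n
      else if n < k then Infinitesimal r n
      else Infinitesimal (- s) k)"

fun times_infinitesimal :: "infinitesimal \<Rightarrow> infinitesimal \<Rightarrow> infinitesimal" where
  "Infinitesimal r n * Infinitesimal s k = Infinitesimal (r * s) (n + k)"

instance ..

end

text \<open>Undefinedness is represented by \<^const>\<open>None\<close>, in contrast to the library convention \<open>r / 0 = 0\<close>.\<close>

fun div_inf :: "infinitesimal \<Rightarrow> infinitesimal \<Rightarrow> infinitesimal option" where
  "div_inf (Infinitesimal r n) (Infinitesimal s k) =
     (if s = 0 then None else Some (Infinitesimal (r / s) (n - k)))"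

definition div_real :: "real \<Rightarrow> real \<Rightarrow> real option" where
  "div_real a b = (if b = 0 then None else Some (a / b))"

definition differentiable_distribution :: "real measure \<Rightarrow> bool" where
  "differentiable_distribution D \<longleftrightarrow>
     real_distribution D \<and> (\<forall>t. cdf D differentiable (at t))"

definition pdf :: "real measure \<Rightarrow> real \<Rightarrow> real" where
  "pdf D s = deriv (cdf D) s"

text \<open>The two versions of $P(D,(s,w))$, for a real width and for an infinitesimal one. The latter is
  undefined for a negative exponent.\<close>

definition interval_prob :: "real measure \<Rightarrow> real \<Rightarrow> real \<Rightarrow> real" where
  "interval_prob D s w = cdf D (s + 1/2 * w) - cdf D (s - 1/2 * w)"

fun interval_prob_inf :: "real measure \<Rightarrow> real \<Rightarrow> infinitesimal \<Rightarrow> infinitesimal option" where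
  "interval_prob_inf D s (Infinitesimal r n) =
     (if n = 0 then Some (const_inf (interval_prob D s r))
      else if n > 0 then Some (const_inf (pdf D s) * Infinitesimal r n)
      else None)"

text \<open>\<open>Prob D s r\<close> stands for the term $P(D,(s,rx))$. The bare variable $x$ is not itself an
  expression.\<close>

datatype prob_expr =
    Const real
  | Prob "real measure" real real
  | Add prob_expr prob_expr
  | Sub prob_expr prob_expr
  | Mul prob_expr prob_expr
  | Div prob_expr prob_expr

text \<open>\<^typ>\<open>real measure\<close> also contains measures that are not distributions with a differentiable
  cumulative distribution function, so these are excluded here.\<close>

primrec wf_prob_expr :: "prob_expr \<Rightarrow> bool" where
  "wf_prob_expr (Const c) \<longleftrightarrow> True"
| "wf_prob_expr (Prob D s r) \<longleftrightarrow> differentiable_distribution D"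
| "wf_prob_expr (Add e1 e2) \<longleftrightarrow> wf_prob_expr e1 \<and> wf_prob_expr e2"
| "wf_prob_expr (Sub e1 e2) \<longleftrightarrow> wf_prob_expr e1 \<and> wf_prob_expr e2"
| "wf_prob_expr (Mul e1 e2) \<longleftrightarrow> wf_prob_expr e1 \<and> wf_prob_expr e2"
| "wf_prob_expr (Div e1 e2) \<longleftrightarrow> wf_prob_expr e1 \<and> wf_prob_expr e2"

primrec eval_real :: "prob_expr \<Rightarrow> real \<Rightarrow> real option" where
  "eval_real (Const c) x = Some c"
| "eval_real (Prob D s r) x = Some (interval_prob D s (r * x))"
| "eval_real (Add e1 e2) x = do { a \<leftarrow> eval_real e1 x; b \<leftarrow> eval_real e2 x; Some (a + b) }"
| "eval_real (Sub e1 e2) x = do { a \<leftarrow> eval_real e1 x; b \<leftarrow> eval_real e2 x; Some (a - b) }"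
| "eval_real (Mul e1 e2) x = do { a \<leftarrow> eval_real e1 x; b \<leftarrow> eval_real e2 x; Some (a * b) }"
| "eval_real (Div e1 e2) x = do { a \<leftarrow> eval_real e1 x; b \<leftarrow> eval_real e2 x; div_real a b }"

primrec eval_inf :: "prob_expr \<Rightarrow> infinitesimal \<Rightarrow> infinitesimal option" where
  "eval_inf (Const c) x = Some (const_inf c)"
| "eval_inf (Prob D s r) x = interval_prob_inf D s (const_inf r * x)"
| "eval_inf (Add e1 e2) x = do { a \<leftarrow> eval_inf e1 x; b \<leftarrow> eval_inf e2 x; Some (a + b) }"
| "eval_inf (Sub e1 e2) x = do { a \<leftarrow> eval_inf e1 x; b \<leftarrow> eval_inf e2 x; Some (a - b) }"
| "eval_inf (Mul e1 e2) x = do { a \<leftarrow> eval_inf e1 x; b \<leftarrow> eval_inf e2 x; Some (a * b) }"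
| "eval_inf (Div e1 e2) x = do { a \<leftarrow> eval_inf e1 x; b \<leftarrow> eval_inf e2 x; div_inf a b }"

end

theory Submission
  imports Defs
begin

text \<open>\<open>f(\<epsilon>)\<close> computes the leading term at \<open>0\<close> of the real function \<open>f\<close>: each operation of
  infinitesimal arithmetic is the rule by which the corresponding real operation acts on leading
  terms, and \<open>P(D, (s, r x))\<close> has the leading term \<open>pdf(D, s) r x\<close>, which is the derivative of
  \<open>cdf(D, s + r x / 2) - cdf(D, s - r x / 2)\<close> at \<open>0\<close>. The claim follows by induction on the
  expression. A quotient is defined near \<open>0\<close> because a function whose leading coefficient is nonzero
  does not vanish there.\<close>

text \<open>This is \<open>g x = r * x powi n + o(x powi n)\<close>. The coefficient
  \<open>r\<close> may be 0, and then only \<open>g x = o(x powi n)\<close> is claimed; pairs such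
  as \<open>Infinitesimal 0 1\<close> need this reading.\<close>

fun has_leading_term :: "(real \<Rightarrow> real) \<Rightarrow> infinitesimal \<Rightarrow> bool" where
  "has_leading_term g (Infinitesimal r n) \<longleftrightarrow> ((\<lambda>x. g x / x powi n) \<longlongrightarrow> r) (at 0)"

lemma eventually_at_0_nonzero: "\<forall>\<^sub>F x :: real in at 0. x \<noteq> 0"
  by (simp add: eventually_at_filter)

lemma power_int_tendsto_0:
  assumes "m > 0"
  shows "((\<lambda>x :: real. x powi m) \<longlongrightarrow> 0) (at 0)"
proof -
  have "((\<lambda>x :: real. x ^ nat m) \<longlongrightarrow> 0 ^ nat m) (at 0)"
    by (intro tendsto_intros)
  with assms show ?thesis
    by (simp add: power_int_def)
qed

text \<open>Since \<open>h x / x powi n\<close> is \<open>h x / x powi k\<close> times a positive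
  power of \<open>x\<close>, a bounded factor meets one that vanishes. This is why infinitesimal
  addition may drop the summand with the larger exponent.\<close>

lemma higher_order_tendsto_0:
  assumes "((\<lambda>x :: real. h x / x powi k) \<longlongrightarrow> s) (at 0)" "n < k"
  shows "((\<lambda>x. h x / x powi n) \<longlongrightarrow> 0) (at 0)"
proof -
  have "((\<lambda>x. h x / x powi k * x powi (k - n)) \<longlongrightarrow> s * 0) (at 0)"
    using assms by (intro tendsto_mult power_int_tendsto_0) auto
  moreover have "\<forall>\<^sub>F x in at 0. h x / x powi k * x powi (k - n) = h x / x powi n"
    using eventually_at_0_nonzero by eventually_elim (simp add: power_int_diff)
  ultimately show ?thesis
    using Lim_transform_eventually by fastforce
qed

lemma has_leading_term_const: "has_leading_term (\<lambda>_. c) (const_inf c)"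
  by (simp add: const_inf_def)

lemma has_leading_term_add:
  assumes "has_leading_term g a" "has_leading_term h b"
  shows "has_leading_term (\<lambda>x. g x + h x) (a + b)"
proof (cases a, cases b)
  fix r s n k
  assume a: "a = Infinitesimal r n" and b: "b = Infinitesimal s k"
  have g: "((\<lambda>x. g x / x powi n) \<longlongrightarrow> r) (at 0)" and h: "((\<lambda>x. h x / x powi k) \<longlongrightarrow> s) (at 0)"
    using assms a b by simp_all
  consider "n = k" | "n < k" | "k < n"
    by linarith
  then show ?thesis
  proof cases
    case 1
    then show ?thesis
      using tendsto_add[OF g h] by (simp add: a b add_divide_distrib)
  next
    case 2
    then show ?thesis
      using tendsto_add[OF g higher_order_tendsto_0[OF h 2]] by (simp add: a b add_divide_distrib)
  next
    case 3
    then show ?thesis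
      using tendsto_add[OF higher_order_tendsto_0[OF g 3] h] by (simp add: a b add_divide_distrib)
  qed
qed

lemma has_leading_term_mult:
  assumes "has_leading_term g a" "has_leading_term h b"
  shows "has_leading_term (\<lambda>x. g x * h x) (a * b)"
proof (cases a, cases b)
  fix r s n k
  assume a: "a = Infinitesimal r n" and b: "b = Infinitesimal s k"
  have "((\<lambda>x. (g x / x powi n) * (h x / x powi k)) \<longlongrightarrow> r * s) (at 0)"
    using assms a b by (intro tendsto_mult) simp_all
  moreover have "\<forall>\<^sub>F x in at 0.
      (g x / x powi n) * (h x / x powi k) = g x * h x / x powi (n + k)"
    using eventually_at_0_nonzero by eventually_elim (simp add: power_int_add)
  ultimately show ?thesis
    unfolding a b times_infinitesimal.simps has_leading_term.simps
    by (rule Lim_transform_eventually)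
qed

lemma has_leading_term_diff:
  assumes "has_leading_term g a" "has_leading_term h b"
  shows "has_leading_term (\<lambda>x. g x - h x) (a - b)"
proof -
  \<comment> \<open>Multiplying by \<open>const_inf (- 1)\<close> negates the coefficient and keeps
    the exponent, so the case distinctions of \<open>-\<close> and \<open>+\<close> match.\<close>
  have "a - b = a + const_inf (- 1) * b"
    by (cases a; cases b) (simp add: const_inf_def)
  then show ?thesis
    using has_leading_term_add[OF assms(1)
      has_leading_term_mult[OF has_leading_term_const[of "- 1"] assms(2)]]
    by simp
qed

lemma has_leading_term_divide:
  assumes "has_leading_term g a" "has_leading_term h b" "div_inf a b = Some c"
  shows "has_leading_term (\<lambda>x. g x / h x) c"
proof (cases a, cases b)
  fix r s n k
  assume a: "a = Infinitesimal r n" and b: "b = Infinitesimal s k"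
  have "s \<noteq> 0" and c: "c = Infinitesimal (r / s) (n - k)"
    using assms(3) a b by (auto split: if_splits)
  then have "((\<lambda>x. (g x / x powi n) / (h x / x powi k)) \<longlongrightarrow> r / s) (at 0)"
    using assms(1,2) a b by (intro tendsto_divide) simp_all
  \<comment> \<open>The equation needs no \<open>h x \<noteq> 0\<close>: where
    \<open>h x = 0\<close>, both sides are 0 by the convention for division by zero.\<close>
  moreover have "\<forall>\<^sub>F x in at 0.
      (g x / x powi n) / (h x / x powi k) = g x / h x / x powi (n - k)"
    using eventually_at_0_nonzero by eventually_elim (simp add: power_int_diff)
  ultimately show ?thesis
    unfolding c has_leading_term.simps by (rule Lim_transform_eventually)
qed

text \<open>The limit of a quotient of total functions does not show that \<open>div_real\<close> is
  defined. Definedness of \<open>div_inf a b\<close> supplies this: the limit of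
  \<open>h x / x powi k\<close> is then nonzero, which excludes zeros of \<open>h\<close> near
  0.\<close>

lemma has_leading_term_eventually_nonzero:
  assumes "has_leading_term h b" "div_inf a b \<noteq> None"
  shows "\<forall>\<^sub>F x in at 0. h x \<noteq> 0"
proof (cases a, cases b)
  fix r s n k
  assume a: "a = Infinitesimal r n" and b: "b = Infinitesimal s k"
  have "\<forall>\<^sub>F x in at 0. h x / x powi k \<noteq> 0"
    using assms a b by (intro tendsto_imp_eventually_ne[where c = s]) (auto split: if_splits)
  then show ?thesis
    by eventually_elim auto
qed

lemma has_leading_term_interval_prob:
  assumes "differentiable_distribution D"
  shows "has_leading_term (\<lambda>x. interval_prob D s (r * x)) (Infinitesimal (pdf D s * r) 1)"
proof -
  have cdf: "(cdf D has_field_derivative pdf D s) (at s)"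
    using assms by (simp add: differentiable_distribution_def pdf_def DERIV_deriv_iff_real_differentiable)
  \<comment> \<open>At \<open>x = 0\<close> both endpoints equal \<open>s\<close>, so the chain rule
    uses the derivative of the cdf at \<open>s\<close> twice, with inner derivatives
    \<open>r / 2\<close> and \<open>- r / 2\<close>.\<close>
  have "((\<lambda>x. interval_prob D s (r * x)) has_field_derivative pdf D s * (r / 2) - pdf D s * (- r / 2)) (at 0)"
    unfolding interval_prob_def
    using cdf by (intro DERIV_diff DERIV_chain2[where f = "cdf D"]) (auto intro!: derivative_eq_intros)
  \<comment> \<open>The interval of width 0 has probability 0, so the difference quotient at 0 is
    the function divided by \<open>x\<close>.\<close>
  then show ?thesis
    by (simp add: has_field_derivative_iff interval_prob_def algebra_simps)
qed

text \<open>The total function \<open>g\<close> replaces the partial \<open>eval_real f\<close> near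
  0, so that limits of real functions apply. Agreement is only eventual because \<open>f\<close> may
  be undefined at 0 or far from it.\<close>

lemma eval_real_has_leading_term:
  assumes "wf_prob_expr f" "eval_inf f eps = Some a"
  shows "\<exists>g. (\<forall>\<^sub>F x in at 0. eval_real f x = Some (g x)) \<and> has_leading_term g a"
  using assms
proof (induction f arbitrary: a)
  case (Const c)
  then show ?case
    using has_leading_term_const[of c] by (intro exI[of _ "\<lambda>_. c"]) simp
next
  case (Prob D s r)
  then show ?case
    using has_leading_term_interval_prob[of D s r]
    \<comment> \<open>The width \<open>const_inf r * eps\<close> has exponent 1 even for
      \<open>r = 0\<close>, so the density case of \<open>interval_prob_inf\<close> applies.\<close>
    by (intro exI[of _ "\<lambda>x. interval_prob D s (r * x)"]) (auto simp: eps_def const_inf_def)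
next
  case (Add f1 f2)
  then obtain b1 b2 where "eval_inf f1 eps = Some b1" "eval_inf f2 eps = Some b2" and a: "a = b1 + b2"
    by (auto simp: bind_eq_Some_conv)
  with Add obtain g1 g2 where
    ev: "\<forall>\<^sub>F x in at 0. eval_real f1 x = Some (g1 x)" "\<forall>\<^sub>F x in at 0. eval_real f2 x = Some (g2 x)"
    and g: "has_leading_term g1 b1" "has_leading_term g2 b2"
    by (metis wf_prob_expr.simps(3))
  from ev have "\<forall>\<^sub>F x in at 0. eval_real (Add f1 f2) x = Some (g1 x + g2 x)"
    by eventually_elim simp
  with has_leading_term_add[OF g] show ?case
    unfolding a by (intro exI[of _ "\<lambda>x. g1 x + g2 x"]) simp
next
  case (Sub f1 f2)
  then obtain b1 b2 where "eval_inf f1 eps = Some b1" "eval_inf f2 eps = Some b2" and a: "a = b1 - b2"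
    by (auto simp: bind_eq_Some_conv)
  with Sub obtain g1 g2 where
    ev: "\<forall>\<^sub>F x in at 0. eval_real f1 x = Some (g1 x)" "\<forall>\<^sub>F x in at 0. eval_real f2 x = Some (g2 x)"
    and g: "has_leading_term g1 b1" "has_leading_term g2 b2"
    by (metis wf_prob_expr.simps(4))
  from ev have "\<forall>\<^sub>F x in at 0. eval_real (Sub f1 f2) x = Some (g1 x - g2 x)"
    by eventually_elim simp
  with has_leading_term_diff[OF g] show ?case
    unfolding a by (intro exI[of _ "\<lambda>x. g1 x - g2 x"]) simp
next
  case (Mul f1 f2)
  then obtain b1 b2 where "eval_inf f1 eps = Some b1" "eval_inf f2 eps = Some b2" and a: "a = b1 * b2"
    by (auto simp: bind_eq_Some_conv)
  with Mul obtain g1 g2 where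
    ev: "\<forall>\<^sub>F x in at 0. eval_real f1 x = Some (g1 x)" "\<forall>\<^sub>F x in at 0. eval_real f2 x = Some (g2 x)"
    and g: "has_leading_term g1 b1" "has_leading_term g2 b2"
    by (metis wf_prob_expr.simps(5))
  from ev have "\<forall>\<^sub>F x in at 0. eval_real (Mul f1 f2) x = Some (g1 x * g2 x)"
    by eventually_elim simp
  with has_leading_term_mult[OF g] show ?case
    unfolding a by (intro exI[of _ "\<lambda>x. g1 x * g2 x"]) simp
next
  case (Div f1 f2)
  then obtain b1 b2 where "eval_inf f1 eps = Some b1" "eval_inf f2 eps = Some b2"
    and a: "div_inf b1 b2 = Some a"
    by (auto simp: bind_eq_Some_conv)
  with Div obtain g1 g2 where
    ev: "\<forall>\<^sub>F x in at 0. eval_real f1 x = Some (g1 x)" "\<forall>\<^sub>F x in at 0. eval_real f2 x = Some (g2 x)"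
    and g: "has_leading_term g1 b1" "has_leading_term g2 b2"
    by (metis wf_prob_expr.simps(6))
  \<comment> \<open>Where \<open>g2 x = 0\<close>, \<open>g1 x / g2 x\<close> would be 0 but
    \<open>div_real\<close> gives \<open>None\<close>.\<close>
  have "\<forall>\<^sub>F x in at 0. g2 x \<noteq> 0"
    using has_leading_term_eventually_nonzero[OF g(2), of b1] a by simp
  with ev have "\<forall>\<^sub>F x in at 0. eval_real (Div f1 f2) x = Some (g1 x / g2 x)"
    by eventually_elim (simp add: div_real_def)
  with has_leading_term_divide[OF g a] show ?case
    by (intro exI[of _ "\<lambda>x. g1 x / g2 x"]) simp
qed

theorem theorem5p5:
  fixes f :: prob_expr and r :: real and n :: int
  assumes "wf_prob_expr f"
    and "eval_inf f eps = Some (Infinitesimal r n)"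
  shows "(\<forall>\<^sub>F x in at 0. eval_real f x \<noteq> None) \<and>
         ((\<lambda>x. the (eval_real f x) / x powi n) \<longlongrightarrow> r) (at 0)"
proof -
  obtain g where ev: "\<forall>\<^sub>F x in at 0. eval_real f x = Some (g x)"
    and g: "has_leading_term g (Infinitesimal r n)"
    using eval_real_has_leading_term[OF assms] by blast
  have "((\<lambda>x. the (eval_real f x) / x powi n) \<longlongrightarrow> r) (at 0)"
  proof (rule Lim_transform_eventually)
    show "((\<lambda>x. g x / x powi n) \<longlongrightarrow> r) (at 0)"
      using g by simp
    show "\<forall>\<^sub>F x in at 0. g x / x powi n = the (eval_real f x) / x powi n"
      using ev by eventually_elim simp
  qed
  moreover have "\<forall>\<^sub>F x in at 0. eval_real f x \<noteq> None"
    using ev by eventually_elim simp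
  ultimately show ?thesis
    by simp
qed

end
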